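(* Let $N\geq 2$ be an integer, let $\mathcal{A}$ be an associative unital $\mathbb{Z}_N$-graded algebra over $\mathbb{C}$ with unity element $e$, let $q\in\mathbb{C}$ be a primitive $N$-th root of unity, and let $v\in\mathcal{A}^1$ be an element of grading $1$ such that $v^N=\alpha e$ for some $\alpha\in\mathbb{C}$. Let $d_v:\mathcal{A}\to\mathcal{A}$ be the linear map given on homogeneous elements by $d_v w=[v,w]_q=vw-q^{|w|}wv$. Then $d_v^N w=0$ for every $w\in\mathcal{A}$.
   Context: $\mathbb{Z}_N=\mathbb{Z}/N\mathbb{Z}$. $\mathcal{A}^k\subset\mathcal{A}$ denotes the subspace of homogeneous elements of grading $k\in\mathbb{Z}_N$ (so $\mathcal{A}=\bigoplus_k\mathcal{A}^k$ and $\mathcal{A}^k\mathcal{A}^l\subset\mathcal{A}^{k+l}$), and $|w|=k$ means $w\in\mathcal{A}^k$. The $q$-commutator of homogeneous elements $w,w'$ is $[w,w']_q=ww'-q^{|w||w'|}w'w$ (well defined since $q^N=1$). The map $d_v:\mathcal{A}^k\to\mathcal{A}^{k+1}$, $d_vw=[v,w]_q$, is extended linearly to all of $\mathcal{A}$, and $d_v^N$ is its $N$-fold iterate. *)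

theory Defs
  imports Complex_Main "HOL-Library.FuncSet"
begin

text \<open>The sort \<open>{ring, monoid_mult}\<close> is that of associative unital rings without the axiom
  \<open>0 \<noteq> 1\<close> of \<open>ring_1\<close>, so that the zero algebra is not excluded.\<close>

locale complex_algebra = vector_space scale
  for scale :: "complex \<Rightarrow> 'a :: {ring, monoid_mult} \<Rightarrow> 'a" (infixr \<open>*s\<close> 75) +
  assumes scale_mult_left: "(c *s x) * y = c *s (x * y)"
    and scale_mult_right: "x * (c *s y) = c *s (x * y)"

text \<open>The degrees in \<open>\<int>/N\<int>\<close> are represented by the residues \<open>0, \<dots>, N - 1\<close>; only the values of
  \<open>G\<close> at these are used. The direct sum condition says that every element has exactly one family
  of homogeneous components; \<open>\<Pi>\<^sub>E\<close> makes families unique outside \<open>{..<N}\<close>.\<close>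

locale cyclic_graded_algebra = complex_algebra scale
  for scale :: "complex \<Rightarrow> 'a :: {ring, monoid_mult} \<Rightarrow> 'a" (infixr \<open>*s\<close> 75) +
  fixes N :: nat and G :: "nat \<Rightarrow> 'a set"
  assumes N_pos: "0 < N"
    and subspace_grade: "k < N \<Longrightarrow> subspace (G k)"
    and direct_sum: "\<exists>!f. f \<in> (\<Pi>\<^sub>E k\<in>{..<N}. G k) \<and> w = (\<Sum>k<N. f k)"
    and grade_mult: "k < N \<Longrightarrow> l < N \<Longrightarrow> x \<in> G k \<Longrightarrow> y \<in> G l \<Longrightarrow> x * y \<in> G ((k + l) mod N)"

definition homogeneous_component ::
  "nat \<Rightarrow> (nat \<Rightarrow> 'a :: {ring, monoid_mult} set) \<Rightarrow> 'a \<Rightarrow> nat \<Rightarrow> 'a" where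
  "homogeneous_component N G w = (THE f. f \<in> (\<Pi>\<^sub>E k\<in>{..<N}. G k) \<and> w = (\<Sum>k<N. f k))"

definition primitive_root_of_unity :: "nat \<Rightarrow> complex \<Rightarrow> bool" where
  "primitive_root_of_unity N q \<longleftrightarrow> 0 < N \<and> q ^ N = 1 \<and> (\<forall>k. 0 < k \<and> k < N \<longrightarrow> q ^ k \<noteq> 1)"

text \<open>The gradings \<open>k\<close> of \<open>x\<close> and \<open>l\<close> of \<open>y\<close> are passed explicitly, since \<open>0\<close> has every grading.\<close>

definition q_commutator ::
  "(complex \<Rightarrow> 'a :: {ring, monoid_mult} \<Rightarrow> 'a) \<Rightarrow> complex \<Rightarrow> nat \<Rightarrow> nat \<Rightarrow> 'a \<Rightarrow> 'a \<Rightarrow> 'a" where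
  "q_commutator scale q k l x y = x * y - scale (q ^ (k * l)) (y * x)"

text \<open>The map \<open>d\<^sub>v\<close> for \<open>v\<close> of grading \<open>1\<close>; its characterization as the linear map
  with \<open>d\<^sub>v w = v w - q\<^bsup>|w|\<^esup> w v\<close> on homogeneous \<open>w\<close> is proved below.\<close>

definition q_differential ::
  "(complex \<Rightarrow> 'a :: {ring, monoid_mult} \<Rightarrow> 'a) \<Rightarrow> nat \<Rightarrow> (nat \<Rightarrow> 'a set) \<Rightarrow> complex
    \<Rightarrow> 'a \<Rightarrow> 'a \<Rightarrow> 'a" where
  "q_differential scale N G q v w =
     (\<Sum>k<N. q_commutator scale q 1 k v (homogeneous_component N G w k))"

lemma q_commutator_mod:
  assumes "q ^ N = 1"
  shows "q_commutator scale q (k mod N) (l mod N) x y = q_commutator scale q k l x y"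
proof -
  have pow: "q ^ m = q ^ (m mod N)" for m
  proof -
    have "q ^ m = q ^ (N * (m div N) + m mod N)" by simp
    also have "\<dots> = q ^ (m mod N)" by (simp only: power_add power_mult assms power_one mult_1)
    finally show ?thesis .
  qed
  have "q ^ (k mod N * (l mod N)) = q ^ (k * l)"
    using pow[of "k mod N * (l mod N)"] pow[of "k * l"] by (simp add: mod_mult_eq)
  then show ?thesis by (simp add: q_commutator_def)
qed

context cyclic_graded_algebra
begin

lemma homogeneous_component_props:
  "homogeneous_component N G w \<in> (\<Pi>\<^sub>E k\<in>{..<N}. G k)"
  "(\<Sum>k<N. homogeneous_component N G w k) = w"
  using theI'[OF direct_sum[of w]] by (auto simp: homogeneous_component_def)

lemma homogeneous_component_eqI:
  assumes "\<And>k. k < N \<Longrightarrow> f k \<in> G k" "w = (\<Sum>k<N. f k)" "k < N"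
  shows "homogeneous_component N G w k = f k"
proof -
  have "restrict f {..<N} \<in> (\<Pi>\<^sub>E k\<in>{..<N}. G k) \<and> w = (\<Sum>k<N. restrict f {..<N} k)"
    using assms by auto
  then have "homogeneous_component N G w = restrict f {..<N}"
    unfolding homogeneous_component_def using the1_equality[OF direct_sum] by blast
  then show ?thesis using assms(3) by simp
qed

lemma component_in_grade: "k < N \<Longrightarrow> homogeneous_component N G w k \<in> G k"
  using homogeneous_component_props(1)[of w] by auto

lemma component_add:
  assumes "k < N"
  shows "homogeneous_component N G (x + y) k =
    homogeneous_component N G x k + homogeneous_component N G y k"
  by (rule homogeneous_component_eqI)
    (use assms in \<open>auto simp: sum.distrib homogeneous_component_props(2)
      intro: subspace_add subspace_grade component_in_grade\<close>)

lemma component_scale: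
  assumes "k < N"
  shows "homogeneous_component N G (c *s x) k = c *s homogeneous_component N G x k"
  by (rule homogeneous_component_eqI)
    (use assms in \<open>auto simp: scale_sum_right[symmetric] homogeneous_component_props(2)
      intro: subspace_scale subspace_grade component_in_grade\<close>)

lemma component_homogeneous:
  assumes "k < N" "w \<in> G k" "j < N"
  shows "homogeneous_component N G w j = (if j = k then w else 0)"
  by (rule homogeneous_component_eqI)
    (use assms in \<open>auto simp: subspace_0 subspace_grade\<close>)

lemma q_differential_homogeneous:
  assumes "k < N" "w \<in> G k"
  shows "q_differential scale N G q v w = v * w - q ^ k *s (w * v)"
proof -
  have "q_differential scale N G q v w =
      (\<Sum>j<N. if j = k then v * w - q ^ k *s (w * v) else 0)"
    unfolding q_differential_def
    by (rule sum.cong) (auto simp: q_commutator_def component_homogeneous[OF assms])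
  also have "\<dots> = v * w - q ^ k *s (w * v)" using assms by simp
  finally show ?thesis .
qed

lemma linear_q_differential: "Vector_Spaces.linear scale scale (q_differential scale N G q v)"
  by unfold_locales
    (auto simp: q_differential_def q_commutator_def component_add component_scale
      scale_mult_left scale_mult_right scale_right_distrib scale_right_diff_distrib
      scale_sum_right sum.distrib[symmetric] distrib_left distrib_right mult.commute
      intro!: sum.cong)

lemma q_differential_unique:
  assumes "Vector_Spaces.linear scale scale d"
    and "\<And>k w. k < N \<Longrightarrow> w \<in> G k \<Longrightarrow> d w = v * w - q ^ k *s (w * v)"
  shows "d = q_differential scale N G q v"
proof
  fix w
  interpret d: Vector_Spaces.linear scale scale d by fact
  have "d w = d (\<Sum>k<N. homogeneous_component N G w k)"
    by (simp add: homogeneous_component_props(2))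
  also have "\<dots> = q_differential scale N G q v w"
    unfolding d.sum q_differential_def q_commutator_def
    by (rule sum.cong) (auto simp: assms(2) component_in_grade)
  finally show "d w = q_differential scale N G q v w" .
qed

end

end

theory Submission
  imports Defs "HOL-Computational_Algebra.Polynomial"
begin

text \<open>For \<open>w\<close> of grading \<open>k\<close>, the \<open>n\<close>-th iterate of \<open>d\<^sub>v\<close> acts on \<open>w\<close> as
  \<open>(L - q\<^bsup>k+n-1\<^esup> R) \<dots> (L - q\<^bsup>k\<^esup> R)\<close>, where \<open>L\<close> and \<open>R\<close> are multiplication by \<open>v\<close> from the left
  and from the right: each application raises the grading, hence the exponent of \<open>q\<close>, by one.
  By associativity \<open>L\<close> and \<open>R\<close> commute, so this operator is the homogenization, evaluated at
  \<open>L\<close> and \<open>R\<close>, of the polynomial \<open>\<Prod>j<n. (1 - q\<^bsup>k+j\<^esup> X)\<close> (lemma \<open>q_differential_iterate\<close>).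

  For \<open>n = N\<close> the factors run through all \<open>N\<close>-th roots of unity, and the product is \<open>1 - X\<^sup>N\<close>
  (lemma \<open>prod_roots_of_unity\<close>). Therefore the \<open>N\<close>-th iterate maps \<open>w\<close> to
  \<open>L\<^sup>N w - R\<^sup>N w = v\<^sup>N w - w v\<^sup>N\<close>, which vanishes because \<open>v\<^sup>N\<close> is a scalar. Linearity of
  \<open>d\<^sub>v\<close> extends this from homogeneous elements to the whole algebra.\<close>

lemma primitive_root_of_unity_inj:
  assumes "primitive_root_of_unity N q"
  shows "inj_on (\<lambda>j. q ^ j) {..<N}"
proof (rule linorder_inj_onI)
  fix i j assume ij: "i < j" "i \<in> {..<N}" "j \<in> {..<N}"
  have q0: "q \<noteq> 0"
    using assms by (auto simp: primitive_root_of_unity_def power_0_left split: if_splits)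
  have "q ^ j = q ^ i * q ^ (j - i)"
    using ij by (simp flip: power_add)
  moreover have "q ^ (j - i) \<noteq> 1"
    using assms ij by (auto simp: primitive_root_of_unity_def)
  ultimately show "q ^ i \<noteq> q ^ j"
    using q0 by simp
qed auto

lemma degree_prod_linear_le:
  fixes c :: "nat \<Rightarrow> complex"
  shows "degree (\<Prod>j<n. [:1, - c j:]) \<le> n"
proof -
  have "degree (\<Prod>j<n. [:1, - c j:]) \<le> (\<Sum>j<n. degree [:1, - c j:])"
    using degree_prod_sum_le[of "{..<n}" "\<lambda>j. [:1, - c j:]"] by (simp only: o_def finite_lessThan)
  also have "\<dots> \<le> (\<Sum>j<n. 1)"
    by (intro sum_mono) simp
  finally show ?thesis by simp
qed

text \<open>Both sides have degree at most \<open>N\<close>, and they agree at the \<open>N + 1\<close> points \<open>0\<close> and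
  \<open>q\<^sup>m\<close>, \<open>m < N\<close>: at \<open>0\<close> both are \<open>1\<close>, and at \<open>q\<^sup>m\<close> both vanish.\<close>

lemma prod_roots_of_unity:
  assumes "primitive_root_of_unity N q"
  shows "(\<Prod>j<N. [:1, - (q ^ (k + j)):]) = 1 - monom 1 N"
proof (rule poly_eqI_degree)
  let ?A = "insert 0 ((\<lambda>m. q ^ m) ` {..<N})"
  have N: "0 < N" "q ^ N = 1"
    using assms by (auto simp: primitive_root_of_unity_def)
  then have q0: "q \<noteq> 0"
    by (auto simp: power_0_left)
  have card: "card ?A = Suc N"
    using q0 by (subst card_insert_disjoint)
      (auto simp: card_image[OF primitive_root_of_unity_inj[OF assms]])
  show "degree (\<Prod>j<N. [:1, - (q ^ (k + j)):]) < card ?A"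
    using card degree_prod_linear_le[of "\<lambda>j. q ^ (k + j)" N] by simp
  have "degree (1 - monom 1 N :: complex poly) \<le> N"
    by (intro degree_diff_le) (auto simp: degree_monom_le)
  then show "degree (1 - monom 1 N :: complex poly) < card ?A"
    using card by simp
  fix x assume "x \<in> ?A"
  then consider "x = 0" | m where "m < N" "x = q ^ m"
    by auto
  then show "poly (\<Prod>j<N. [:1, - (q ^ (k + j)):]) x = poly (1 - monom 1 N) x"
  proof cases
    case 1
    then show ?thesis using N by (simp add: poly_prod poly_monom power_0_left)
  next
    case (2 m)
    \<comment> \<open>the index \<open>j\<close> of the factor that vanishes at \<open>q\<^sup>m\<close> satisfies \<open>k + j + m \<equiv> 0\<close> modulo \<open>N\<close>\<close>
    define j where "j = (N - (k + m) mod N) mod N"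
    have "(k + j + m) mod N = ((k + m) mod N + (N - (k + m) mod N)) mod N"
      unfolding j_def by (metis add.assoc add.commute mod_add_left_eq mod_add_right_eq)
    also have "\<dots> = 0"
      using N by (simp add: less_imp_le)
    finally obtain t where "k + j + m = N * t"
      by blast
    then have "q ^ (k + j) * x = 1"
      using N 2 by (simp add: power_mult flip: power_add)
    moreover have "j < N"
      using N by (simp add: j_def)
    ultimately have "(\<Prod>j<N. 1 - q ^ (k + j) * x) = 0"
      by (intro prod_zero) auto
    moreover have "x ^ N = 1"
      using N 2 by (metis mult.commute power_mult power_one)
    ultimately show ?thesis
      by (simp add: poly_prod poly_monom mult.commute)
  qed
qed

context complex_algebra
begin

text \<open>The homogenization of degree \<open>n\<close> of the polynomial \<open>p\<close>, evaluated at the left and the right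
  multiplication by \<open>v\<close> and applied to \<open>w\<close>; coefficients of \<open>p\<close> beyond \<open>n\<close> are cut off.\<close>

definition two_sided_eval :: "'a \<Rightarrow> nat \<Rightarrow> complex poly \<Rightarrow> 'a \<Rightarrow> 'a" where
  "two_sided_eval v n p w = (\<Sum>i\<le>n. coeff p i *s (v ^ (n - i) * w * v ^ i))"

text \<open>Left and right multiplication by \<open>v\<close> commute, so homogenization turns products of
  polynomials into composites of operators; this is the case of one linear factor. The bound on the
  degree keeps the top coefficient from being cut off.\<close>

lemma two_sided_eval_linear_factor:
  assumes "degree p \<le> n"
  shows "two_sided_eval v (Suc n) ([:1, - c:] * p) w =
    v * two_sided_eval v n p w - c *s (two_sided_eval v n p w * v)"
proof -
  have left: "v * two_sided_eval v n p w = two_sided_eval v (Suc n) p w"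
  proof -
    have "coeff p (Suc n) = 0"
      using assms by (simp add: coeff_eq_0)
    then show ?thesis
      by (simp add: two_sided_eval_def sum_distrib_left scale_mult_right Suc_diff_le
          mult.assoc)
  qed
  have right: "two_sided_eval v n p w * v = two_sided_eval v (Suc n) (pCons 0 p) w"
    unfolding two_sided_eval_def sum.atMost_Suc_shift
    by (simp add: sum_distrib_right scale_mult_left mult.assoc power_commutes)
  have "[:1, - c:] * p = p - smult c (pCons 0 p)"
    by simp
  then have "two_sided_eval v (Suc n) ([:1, - c:] * p) w =
      two_sided_eval v (Suc n) p w - c *s two_sided_eval v (Suc n) (pCons 0 p) w"
    by (simp only: two_sided_eval_def coeff_diff coeff_smult scale_left_diff_distrib
        sum_subtractf scale_sum_right scale_scale)
  then show ?thesis
    by (simp only: left right)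
qed

lemma two_sided_eval_one_minus_monom:
  assumes "0 < n"
  shows "two_sided_eval v n (1 - monom 1 n) w = v ^ n * w - w * v ^ n"
proof -
  have "two_sided_eval v n (1 - monom 1 n) w =
      (\<Sum>i\<le>n. (if i = 0 then v ^ n * w else 0) - (if i = n then w * v ^ n else 0))"
    unfolding two_sided_eval_def using assms by (intro sum.cong) auto
  also have "\<dots> = v ^ n * w - w * v ^ n"
    by (simp add: sum_subtractf)
  finally show ?thesis .
qed

end

context cyclic_graded_algebra
begin

lemma q_differential_grade:
  assumes "1 < N" "v \<in> G 1" "k < N" "w \<in> G k"
  shows "q_differential scale N G q v w \<in> G (Suc k mod N)"
proof -
  have "v * w \<in> G (Suc k mod N)" "w * v \<in> G (Suc k mod N)"
    using grade_mult[of 1 k v w] grade_mult[of k 1 w v] assms by simp_all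
  then show ?thesis
    using N_pos by (simp add: q_differential_homogeneous[OF assms(3,4)] subspace_diff
        subspace_scale subspace_grade)
qed

lemma q_differential_iterate_grade:
  assumes "1 < N" "v \<in> G 1" "k < N" "w \<in> G k"
  shows "(q_differential scale N G q v ^^ n) w \<in> G ((k + n) mod N)"
proof (induction n)
  case (Suc n)
  then show ?case
    using q_differential_grade[OF assms(1,2) _ Suc] N_pos by (simp add: mod_Suc_eq)
qed (use assms in simp)

lemma q_differential_iterate:
  assumes "1 < N" "q ^ N = 1" "v \<in> G 1" "k < N" "w \<in> G k"
  shows "(q_differential scale N G q v ^^ n) w =
    two_sided_eval v n (\<Prod>j<n. [:1, - (q ^ (k + j)):]) w"
proof (induction n)
  case 0
  then show ?case by (simp add: two_sided_eval_def)
next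
  case (Suc n)
  let ?D = "q_differential scale N G q v"
  let ?p = "\<Prod>j<n. [:1, - (q ^ (k + j)):]"
  have deg: "degree ?p \<le> n"
    by (rule degree_prod_linear_le)
  have "q ^ (k + n) = q ^ (N * ((k + n) div N) + (k + n) mod N)"
    by simp
  also have "\<dots> = q ^ ((k + n) mod N)"
    by (simp only: power_add power_mult assms(2) power_one mult_1)
  finally have pow: "q ^ ((k + n) mod N) = q ^ (k + n)"
    by simp
  have "(?D ^^ Suc n) w = v * (?D ^^ n) w - q ^ (k + n) *s ((?D ^^ n) w * v)"
    using q_differential_homogeneous[OF _ q_differential_iterate_grade[OF assms(1,3-5)]] N_pos
    by (simp add: pow)
  also have "\<dots> = two_sided_eval v (Suc n) ([:1, - (q ^ (k + n)):] * ?p) w"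
    by (simp only: Suc two_sided_eval_linear_factor[OF deg])
  finally show ?case
    by (simp only: prod.lessThan_Suc mult.commute)
qed

lemma q_differential_iterate_sum:
  "(q_differential scale N G q v ^^ n) (\<Sum>k\<in>A. f k) =
    (\<Sum>k\<in>A. (q_differential scale N G q v ^^ n) (f k))"
proof -
  interpret Vector_Spaces.linear scale scale "q_differential scale N G q v"
    by (rule linear_q_differential)
  show ?thesis by (induction n) (simp_all add: sum)
qed

end

theorem theorem1p1:
  fixes scale :: "complex \<Rightarrow> 'a :: {ring, monoid_mult} \<Rightarrow> 'a"
    and N :: nat and G :: "nat \<Rightarrow> 'a set" and q \<alpha> :: complex and v w :: 'a
  assumes "N \<ge> 2"
    and "cyclic_graded_algebra scale N G"
    and "primitive_root_of_unity N q"
    and "v \<in> G 1"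
    and "v ^ N = scale \<alpha> 1"
  shows "(q_differential scale N G q v ^^ N) w = 0"
proof -
  interpret cyclic_graded_algebra scale N G by fact
  let ?D = "q_differential scale N G q v"
  have q: "q ^ N = 1"
    using assms(3) by (simp add: primitive_root_of_unity_def)
  have homogeneous: "(?D ^^ N) x = 0" if "k < N" "x \<in> G k" for k x
  proof -
    have "(?D ^^ N) x = v ^ N * x - x * v ^ N"
      using assms(1) q_differential_iterate[OF _ q assms(4) that]
      by (simp only: prod_roots_of_unity[OF assms(3)] two_sided_eval_one_minus_monom N_pos)
    also have "\<dots> = 0"
      by (simp add: assms(5) scale_mult_left scale_mult_right)
    finally show ?thesis .
  qed
  have "(?D ^^ N) w = (?D ^^ N) (\<Sum>k<N. homogeneous_component N G w k)"
    by (simp add: homogeneous_component_props(2))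
  also have "\<dots> = 0"
    unfolding q_differential_iterate_sum
    by (intro sum.neutral) (auto intro: homogeneous component_in_grade)
  finally show ?thesis .
qed

end
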